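(* Let $n$ and $r$ be integers with $1\leq r\leq \frac{n}{2}-1$, and let $T$ be a tree on $n$ vertices with exactly $r$ branching vertices. Then $\xi^{ce}(T)\leq \xi^{ce}(B(n,r))$.
   Context: A branching vertex of a tree is a vertex of degree at least $3$. For a vertex $x$ of a connected graph $H$, $d_H(x)$ is its degree and $\varepsilon_H(x)$ its eccentricity; $\xi^{ce}(H)=\sum_{x\in V(H)}\frac{d_H(x)}{\varepsilon_H(x)}$. $B(n,r)$ is the greedy tree with degree sequence $(n-2r+1,3,\dots,3,1,\dots,1)$ having one entry $n-2r+1$, $r-1$ entries $3$ and $n-r$ entries $1$. Greedy tree for a non-increasing tree degree sequence $(d_1,\dots,d_n)$: a rooted tree whose root has degree $d_1$, whose vertices at height $1$ have degrees $d_2,\dots,d_{d_1+1}$, and in general the vertices at height $i>1$ number $\sum_{x\text{ at height } i-1}(d(x)-1)$ and receive the largest remaining degrees; at each level degrees are placed left to right in non-increasing order, and going level by level from left to right, each vertex of down-degree $d$ (root: its degree; other vertices: degree minus one) is joined to the first $d$ not-yet-connected vertices of the next level. *)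

theory Defs
  imports Complex_Main
begin

text \<open>
  Undirected graphs are modelled with two-element sets as edges. In \<^verbatim>\<open>Graph_Theory\<close>,
  where graphs are symmetric digraphs, the closed walk a, b, a counts as a cycle, so that
  the notion of tree provided there does not cover undirected trees.
\<close>

record 'a ugraph =
  vertices :: "'a set"
  edges :: "'a set set"

definition simple_graph :: "'a ugraph \<Rightarrow> bool" where
  "simple_graph G \<longleftrightarrow>
     finite (vertices G) \<and> (\<forall>e \<in> edges G. e \<subseteq> vertices G \<and> card e = 2)"

text \<open>Walks are nonempty lists of vertices; the length of a walk is one less than that of its list.\<close>

definition is_walk :: "'a ugraph \<Rightarrow> 'a list \<Rightarrow> bool" where
  "is_walk G p \<longleftrightarrow> p \<noteq> [] \<and> set p \<subseteq> vertices G \<and>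
     (\<forall>i. Suc i < length p \<longrightarrow> {p ! i, p ! Suc i} \<in> edges G)"

definition walk_between :: "'a ugraph \<Rightarrow> 'a \<Rightarrow> 'a list \<Rightarrow> 'a \<Rightarrow> bool" where
  "walk_between G u p v \<longleftrightarrow> is_walk G p \<and> hd p = u \<and> last p = v"

definition connected_graph :: "'a ugraph \<Rightarrow> bool" where
  "connected_graph G \<longleftrightarrow> vertices G \<noteq> {} \<and>
     (\<forall>u \<in> vertices G. \<forall>v \<in> vertices G. \<exists>p. walk_between G u p v)"

definition is_cycle :: "'a ugraph \<Rightarrow> 'a list \<Rightarrow> bool" where
  "is_cycle G p \<longleftrightarrow>
     is_walk G p \<and> distinct p \<and> length p \<ge> 3 \<and> {last p, hd p} \<in> edges G"

definition is_tree :: "'a ugraph \<Rightarrow> bool" where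
  "is_tree G \<longleftrightarrow> simple_graph G \<and> connected_graph G \<and> \<not> (\<exists>p. is_cycle G p)"

definition vertex_degree :: "'a ugraph \<Rightarrow> 'a \<Rightarrow> nat" where
  "vertex_degree G v = card {e \<in> edges G. v \<in> e}"

definition graph_dist :: "'a ugraph \<Rightarrow> 'a \<Rightarrow> 'a \<Rightarrow> nat" where
  "graph_dist G u v = (LEAST k. \<exists>p. walk_between G u p v \<and> length p = Suc k)"

definition eccentricity :: "'a ugraph \<Rightarrow> 'a \<Rightarrow> nat" where
  "eccentricity G v = Max (graph_dist G v ` vertices G)"

definition xi_ce :: "'a ugraph \<Rightarrow> real" where
  "xi_ce G = (\<Sum>v \<in> vertices G. real (vertex_degree G v) / real (eccentricity G v))"

definition branching_vertices :: "'a ugraph \<Rightarrow> 'a set" where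
  "branching_vertices G = {v \<in> vertices G. vertex_degree G v \<ge> 3}"

text \<open>
  The greedy tree of a non-increasing tree degree sequence \<open>ds\<close>. Its vertices are
  numbered level by level, from left to right within each level, starting with the root
  \<open>0\<close>. As \<open>ds\<close> is non-increasing, giving each level in turn the largest remaining degrees,
  placed from left to right in non-increasing order, amounts to vertex \<open>v\<close> receiving
  \<open>ds ! v\<close>. Nothing is intended for lists that are not non-increasing degree sequences
  of trees.
\<close>

definition down_degree :: "nat list \<Rightarrow> nat \<Rightarrow> nat" where
  "down_degree ds v = (if v = 0 then ds ! 0 else ds ! v - 1)"

text \<open>Level \<open>h\<close> consists of the vertices from \<open>level_start ds h\<close> up to, but excluding,
  \<open>level_start ds (Suc h)\<close>.\<close>

fun level_start :: "nat list \<Rightarrow> nat \<Rightarrow> nat" where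
  "level_start ds 0 = 0"
| "level_start ds (Suc 0) = 1"
| "level_start ds (Suc (Suc h)) =
     level_start ds (Suc h) +
     (\<Sum>v = level_start ds h ..< level_start ds (Suc h). down_degree ds v)"

definition greedy_level :: "nat list \<Rightarrow> nat \<Rightarrow> nat set" where
  "greedy_level ds h = {level_start ds h ..< level_start ds (Suc h)}"

text \<open>The first vertex of level \<open>h + 1\<close> not yet connected when the turn of vertex \<open>v\<close> of
  level \<open>h\<close> comes.\<close>

definition first_free :: "nat list \<Rightarrow> nat \<Rightarrow> nat \<Rightarrow> nat" where
  "first_free ds h v =
     level_start ds (Suc h) + (\<Sum>u = level_start ds h ..< v. down_degree ds u)"

definition greedy_children :: "nat list \<Rightarrow> nat \<Rightarrow> nat \<Rightarrow> nat set" where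
  "greedy_children ds h v = {first_free ds h v ..< first_free ds h v + down_degree ds v}"

definition greedy_tree :: "nat list \<Rightarrow> nat ugraph" where
  "greedy_tree ds =
     \<lparr> vertices = {..< length ds},
       edges = {{v, w} | h v w. v \<in> greedy_level ds h \<and> w \<in> greedy_children ds h v} \<rparr>"

text \<open>The truncated subtractions are harmless for \<open>1 \<le> r\<close> and \<open>2 * r \<le> n\<close>.\<close>

definition B_tree :: "nat \<Rightarrow> nat \<Rightarrow> nat ugraph" where
  "B_tree n r = greedy_tree ((n - 2 * r + 1) # replicate (r - 1) 3 @ replicate (n - r) 1)"

end

theory Submission
  imports Defs
begin

text \<open>
  Let \<open>C\<close> be the center of \<open>T\<close>, let \<open>s \<in> {1, 2}\<close> be its size and \<open>\<rho>\<close> the radius. The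
  eccentricity of a vertex is \<open>\<rho>\<close> plus its distance to \<open>C\<close>. Summing over edges instead of
  vertices makes the index a sum, over all vertices but one, of a decreasing function of the
  distance to \<open>C\<close>, so it is large when the balls around \<open>C\<close> are large. As the branching
  vertices have total degree at most \<open>n + r - 2\<close>, a ball of size \<open>k\<close> grows to size at most
  \<open>2 * k + n - 2 * r\<close> in one step. The greedy numbering of \<open>B(n, r)\<close> attains these bounds
  simultaneously, both around the root \<open>0\<close> and around the edge \<open>{0, 1}\<close>. Hence, whichever of
  the two has size \<open>s\<close>, it can be compared with \<open>C\<close>, whether or not it is the center of
  \<open>B(n, r)\<close>: the comparison needs only upper bounds on eccentricities in \<open>B(n, r)\<close>.
\<close>

section \<open>Walks and distances\<close>

text \<open>Fixing the number of edges lets distances be bounded by induction on \<open>k\<close>,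
  without handling lists of vertices.\<close>

definition reach :: "'a ugraph \<Rightarrow> 'a \<Rightarrow> nat \<Rightarrow> 'a \<Rightarrow> bool" where
  "reach G u k v \<longleftrightarrow> (\<exists>p. walk_between G u p v \<and> length p = Suc k)"

lemma is_walk_Cons:
  "is_walk G (u # p) \<longleftrightarrow> u \<in> vertices G \<and> (p = [] \<or> {u, hd p} \<in> edges G \<and> is_walk G p)"
proof (cases p)
  case Nil
  then show ?thesis by (simp add: is_walk_def)
next
  case (Cons v q)
  show ?thesis
  proof
    assume w: "is_walk G (u # p)"
    have "{p ! i, p ! Suc i} \<in> edges G" if "Suc i < length p" for i
      using w that unfolding is_walk_def by (auto dest: spec[of _ "Suc i"])
    moreover have "{u, hd p} \<in> edges G"
      using w Cons unfolding is_walk_def by (auto dest: spec[of _ 0])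
    ultimately show "u \<in> vertices G \<and> (p = [] \<or> {u, hd p} \<in> edges G \<and> is_walk G p)"
      using w Cons unfolding is_walk_def by auto
  next
    assume "u \<in> vertices G \<and> (p = [] \<or> {u, hd p} \<in> edges G \<and> is_walk G p)"
    then show "is_walk G (u # p)"
      using Cons unfolding is_walk_def by (auto simp: nth_Cons split: nat.split)
  qed
qed

lemma is_walk_rev: "is_walk G p \<Longrightarrow> is_walk G (rev p)"
proof -
  assume w: "is_walk G p"
  have "{rev p ! i, rev p ! Suc i} \<in> edges G" if "Suc i < length p" for i
  proof -
    let ?j = "length p - Suc (Suc i)"
    have "{p ! ?j, p ! Suc ?j} \<in> edges G"
      using w that unfolding is_walk_def by auto
    moreover have "rev p ! i = p ! Suc ?j" "rev p ! Suc i = p ! ?j"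
      using that by (auto simp: rev_nth Suc_diff_Suc)
    ultimately show ?thesis by (simp add: insert_commute)
  qed
  then show ?thesis using w unfolding is_walk_def by auto
qed

lemma reach_refl: "u \<in> vertices G \<Longrightarrow> reach G u 0 u"
  unfolding reach_def walk_between_def
  by (rule exI[of _ "[u]"]) (simp add: is_walk_Cons)

lemma reach_step:
  assumes "{u, w} \<in> edges G" "u \<in> vertices G" "reach G w k v"
  shows "reach G u (Suc k) v"
proof -
  obtain p where p: "is_walk G p" "hd p = w" "last p = v" "length p = Suc k"
    using assms(3) unfolding reach_def walk_between_def by blast
  then have "p \<noteq> []" by auto
  then show ?thesis using p assms(1,2)
    unfolding reach_def walk_between_def
    by (intro exI[of _ "u # p"]) (auto simp: is_walk_Cons)
qed

lemma reach_sym: "reach G u k v \<Longrightarrow> reach G v k u"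
  unfolding reach_def walk_between_def
  by (metis hd_rev is_walk_rev last_rev length_rev)

lemma reach_0D: "reach G u 0 v \<Longrightarrow> u = v"
  unfolding reach_def walk_between_def by (auto simp: length_Suc_conv)

lemma reach_SucD:
  assumes "reach G u (Suc k) v"
  shows "\<exists>w. {u, w} \<in> edges G \<and> reach G w k v"
proof -
  obtain p where p: "is_walk G p" "hd p = u" "last p = v" "length p = Suc (Suc k)"
    using assms unfolding reach_def walk_between_def by blast
  then obtain q where q: "p = u # q" "length q = Suc k"
    by (cases p) auto
  then have "q \<noteq> []" by auto
  then show ?thesis using p q unfolding reach_def walk_between_def
    by (intro exI[of _ "hd q"]) (auto simp: is_walk_Cons)
qed

lemma graph_dist_reach: "graph_dist G u v = (LEAST k. reach G u k v)"
  by (simp add: graph_dist_def reach_def)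

lemma graph_dist_le: "reach G u k v \<Longrightarrow> graph_dist G u v \<le> k"
  unfolding graph_dist_reach by (rule Least_le)

lemma reach_graph_dist: "reach G u k v \<Longrightarrow> reach G u (graph_dist G u v) v"
  unfolding graph_dist_reach by (rule LeastI)

lemma connected_reach:
  assumes "connected_graph G" "u \<in> vertices G" "v \<in> vertices G"
  shows "reach G u (graph_dist G u v) v"
proof -
  obtain p where p: "walk_between G u p v"
    using assms unfolding connected_graph_def by blast
  then have "p \<noteq> []" by (auto simp: walk_between_def is_walk_def)
  then have "reach G u (length p - 1) v"
    using p unfolding reach_def by auto
  then show ?thesis by (rule reach_graph_dist)
qed

lemma graph_dist_sym:
  assumes "connected_graph G" "u \<in> vertices G" "v \<in> vertices G"
  shows "graph_dist G u v = graph_dist G v u"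
  by (rule antisym; rule graph_dist_le; rule reach_sym; rule connected_reach) (use assms in auto)

lemma graph_dist_pos:
  assumes "reach G u k v" "u \<noteq> v"
  shows "0 < graph_dist G u v"
  using reach_graph_dist[OF assms(1)] assms(2) reach_0D by (metis gr0I)

lemma graph_dist_step:
  assumes "connected_graph G" "{u, w} \<in> edges G" "u \<in> vertices G" "w \<in> vertices G" "z \<in> vertices G"
  shows "graph_dist G u z \<le> Suc (graph_dist G w z)"
  using assms by (intro graph_dist_le reach_step[where w = w] connected_reach)

lemma graph_dist_le_ecc:
  assumes "finite (vertices G)" "v \<in> vertices G"
  shows "graph_dist G u v \<le> eccentricity G u"
  using assms unfolding eccentricity_def by (intro Max_ge) auto

lemma ecc_le:
  assumes "finite (vertices G)" "vertices G \<noteq> {}"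
    and "\<And>v. v \<in> vertices G \<Longrightarrow> graph_dist G u v \<le> k"
  shows "eccentricity G u \<le> k"
  using assms unfolding eccentricity_def by (subst Max_le_iff) auto

lemma ecc_attained:
  assumes "finite (vertices G)" "vertices G \<noteq> {}"
  obtains z where "z \<in> vertices G" "graph_dist G u z = eccentricity G u"
proof -
  have "eccentricity G u \<in> graph_dist G u ` vertices G"
    unfolding eccentricity_def using assms by (intro Max_in) auto
  then show ?thesis using that by auto
qed

section \<open>Forests\<close>

lemma edgeD:
  assumes "simple_graph G" "e \<in> edges G" "v \<in> e"
  obtains w where "e = {v, w}" "w \<noteq> v" "w \<in> vertices G" "v \<in> vertices G"
proof -
  have "card e = 2" "e \<subseteq> vertices G" using assms unfolding simple_graph_def by auto
  then obtain a b where "e = {a, b}" "a \<noteq> b" unfolding card_2_iff by auto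
  then show ?thesis using that assms \<open>e \<subseteq> vertices G\<close> by fastforce
qed

lemma finite_edges: "simple_graph G \<Longrightarrow> finite (edges G)"
  unfolding simple_graph_def by (rule finite_subset[of _ "Pow (vertices G)"]) auto

text \<open>The first vertex of a longest path has all its neighbours on the path.\<close>

lemma acyclic_low_degree:
  assumes "simple_graph G" "vertices G \<noteq> {}" "\<nexists>p. is_cycle G p"
  shows "\<exists>v \<in> vertices G. vertex_degree G v \<le> 1"
proof (rule ccontr)
  assume contra: "\<not> ?thesis"
  have fin: "finite (vertices G)" using assms(1) by (simp add: simple_graph_def)
  \<comment> \<open>All degrees being at least 2, \<open>a\<close> has a neighbour different from
    any one prescribed vertex \<open>b\<close>.\<close>
  have other: "\<exists>w. {a, w} \<in> edges G \<and> w \<noteq> b \<and> w \<noteq> a \<and> w \<in> vertices G" if "a \<in> vertices G" for a b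
  proof -
    let ?I = "{e \<in> edges G. a \<in> e}"
    have "2 \<le> card ?I" using contra that unfolding vertex_degree_def by force
    moreover have "card {{a, b}} = 1" by simp
    ultimately have "\<not> ?I \<subseteq> {{a, b}}"
      using card_mono[of "{{a, b}}" ?I] by fastforce
    then obtain e where "e \<in> edges G" "a \<in> e" "e \<noteq> {a, b}" by auto
    then show ?thesis using edgeD[OF assms(1)] by metis
  qed
  let ?P = "\<lambda>p. is_walk G p \<and> distinct p"
  obtain v where "v \<in> vertices G" using assms(2) by auto
  then have ex: "?P [v]" by (simp add: is_walk_Cons)
  have bd: "length p \<le> card (vertices G)" if "?P p" for p
    using that fin by (metis card_mono distinct_card is_walk_def)
  obtain p where p: "?P p" and max: "\<And>q. ?P q \<Longrightarrow> length q \<le> length p"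
    using ex_has_greatest_nat[of ?P "[v]" length "Suc (card (vertices G))"] ex bd
    by (metis le_imp_less_Suc)
  obtain a t where pa: "p = a # t" using p by (cases p) (auto simp: is_walk_def)
  have a: "a \<in> vertices G" using p pa by (simp add: is_walk_Cons)
  \<comment> \<open>The vertex to avoid is the second one of the path; on a one-vertex path,
    \<open>a\<close> itself is a harmless default.\<close>
  obtain w where w: "{a, w} \<in> edges G" "w \<noteq> (if t = [] then a else hd t)" "w \<noteq> a" "w \<in> vertices G"
    using other[OF a] by blast
  have "w \<in> set p"
  proof (rule ccontr)
    assume "w \<notin> set p"
    then have "?P (w # p)" using p pa w by (auto simp: is_walk_Cons insert_commute)
    then show False using max by fastforce
  qed
  then obtain i where i: "i < length p" "p ! i = w" by (auto simp: in_set_conv_nth)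
  have "i \<noteq> 0" using i w(3) pa by (metis nth_Cons_0)
  moreover have "i \<noteq> 1"
    using i w(2) pa by (cases t) auto
  ultimately have i2: "2 \<le> i" by simp
  \<comment> \<open>The edge from \<open>w\<close> back to \<open>a\<close> closes this initial
    segment, which has at least three vertices by \<open>i2\<close>.\<close>
  let ?q = "take (Suc i) p"
  have "?q \<noteq> []" using pa by simp
  have "is_walk G ?q"
    using p i \<open>?q \<noteq> []\<close> unfolding is_walk_def by (auto dest: in_set_takeD)
  moreover have "last ?q = w" using i by (simp add: take_Suc_conv_app_nth)
  moreover have "hd ?q = a" using pa by simp
  ultimately have "is_cycle G ?q"
    using p i i2 w unfolding is_cycle_def by (auto simp: insert_commute)
  then show False using assms(3) by blast
qed

text \<open>Deleting a vertex of degree at most 1 removes at most one edge and creates no cycle, so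
  induction applies.\<close>

lemma card_edges_forest:
  assumes "simple_graph G" "vertices G \<noteq> {}" "\<nexists>p. is_cycle G p"
  shows "card (edges G) < card (vertices G)"
  using assms
proof (induction "card (vertices G)" arbitrary: G rule: less_induct)
  case less
  have fin: "finite (vertices G)" using less.prems by (simp add: simple_graph_def)
  obtain v where v: "v \<in> vertices G" "vertex_degree G v \<le> 1"
    using acyclic_low_degree less.prems by blast
  define H where "H = \<lparr>vertices = vertices G - {v}, edges = {e \<in> edges G. v \<notin> e}\<rparr>"
  have sH: "simple_graph H" using less.prems(1) unfolding H_def simple_graph_def by auto
  have cH: "\<nexists>p. is_cycle H p"
    using less.prems(3) unfolding H_def is_cycle_def is_walk_def by fastforce
  have cV: "card (vertices G) = Suc (card (vertices H))"
    using card_Suc_Diff1[OF fin v(1)] by (simp add: H_def)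
  have "edges G = edges H \<union> {e \<in> edges G. v \<in> e}" by (auto simp: H_def)
  then have cE: "card (edges G) \<le> card (edges H) + vertex_degree G v"
    unfolding vertex_degree_def by (metis card_Un_le)
  show ?case
  proof (cases "vertices H = {}")
    case True
    then have V: "vertices G = {v}" using v by (auto simp: H_def)
    have "edges G = {}"
    proof (rule ccontr)
      assume "edges G \<noteq> {}"
      then obtain e where "e \<subseteq> {v}" "card e = 2"
        using less.prems(1) V unfolding simple_graph_def by auto
      then show False using card_mono[of "{v}" e] by simp
    qed
    then show ?thesis using V by simp
  next
    case False
    then have "card (edges H) < card (vertices H)"
      using less.hyps[OF _ sH False cH] cV by simp
    then show ?thesis using cE cV v(2) by simp
  qed
qed

section \<open>Parent functions\<close>

text \<open>Any measure \<open>d\<close> that decreases towards the root \<open>c\<close> will do: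
  for \<open>T\<close> it is the distance to a root, for \<open>B(n, r)\<close> the numbering
  itself.\<close>

definition parent_tree :: "'a ugraph \<Rightarrow> 'a \<Rightarrow> ('a \<Rightarrow> 'a) \<Rightarrow> ('a \<Rightarrow> nat) \<Rightarrow> bool" where
  "parent_tree G c p d \<longleftrightarrow> finite (vertices G) \<and> c \<in> vertices G \<and>
     (\<forall>x \<in> vertices G - {c}. p x \<in> vertices G \<and> d (p x) < d x) \<and>
     edges G = (\<lambda>x. {x, p x}) ` (vertices G - {c})"

text \<open>Two vertices with the same parent edge would be each other's parents, and
  \<open>d\<close> would decrease both ways.\<close>

lemma parent_edges_inj:
  fixes d :: "'a \<Rightarrow> nat"
  assumes "\<And>x. x \<in> A \<Longrightarrow> d (p x) < d x"
  shows "inj_on (\<lambda>x. {x, p x}) A"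
proof (rule inj_onI)
  fix x y assume xy: "x \<in> A" "y \<in> A" "{x, p x} = {y, p y}"
  show "x = y"
  proof (rule ccontr)
    assume "x \<noteq> y"
    then have "x = p y" "y = p x" using xy(3) by (auto simp: doubleton_eq_iff)
    then show False using assms[OF xy(1)] assms[OF xy(2)] by simp
  qed
qed

text \<open>Double counting of incidences: \<open>v\<close> collects \<open>g v\<close> once per
  incident edge, and the edge of \<open>x\<close> has the ends \<open>x\<close> and
  \<open>p x\<close>.\<close>

lemma parent_tree_degree_sum:
  fixes g :: "'a \<Rightarrow> real"
  assumes "parent_tree G c p d"
  shows "(\<Sum>v \<in> vertices G. real (vertex_degree G v) * g v) = (\<Sum>x \<in> vertices G - {c}. g x + g (p x))"
proof -
  let ?V = "vertices G" and ?A = "vertices G - {c}"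
  have fin: "finite ?V" and pr: "\<And>x. x \<in> ?A \<Longrightarrow> p x \<in> ?V \<and> d (p x) < d x"
    and E: "edges G = (\<lambda>x. {x, p x}) ` ?A"
    using assms unfolding parent_tree_def by auto
  have inj: "inj_on (\<lambda>x. {x, p x}) ?A" using parent_edges_inj[of ?A d p] pr by blast
  have deg: "real (vertex_degree G v) = (\<Sum>x \<in> ?A. if v \<in> {x, p x} then 1 else 0)" for v
  proof -
    have "{e \<in> edges G. v \<in> e} = (\<lambda>x. {x, p x}) ` {x \<in> ?A. v \<in> {x, p x}}"
      using E by blast
    moreover have "inj_on (\<lambda>x. {x, p x}) {x \<in> ?A. v \<in> {x, p x}}"
      using inj by (rule inj_on_subset) blast
    ultimately have "vertex_degree G v = card {x \<in> ?A. v \<in> {x, p x}}"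
      unfolding vertex_degree_def by (metis (no_types, lifting) card_image)
    also have "real \<dots> = (\<Sum>x \<in> ?A. if v \<in> {x, p x} then 1 else 0)"
      using fin by (simp add: sum.If_cases Int_def)
    finally show ?thesis .
  qed
  have "(\<Sum>v \<in> ?V. real (vertex_degree G v) * g v)
      = (\<Sum>v \<in> ?V. \<Sum>x \<in> ?A. if v \<in> {x, p x} then g v else 0)"
    unfolding deg sum_distrib_right by (intro sum.cong) simp_all
  also have "\<dots> = (\<Sum>x \<in> ?A. \<Sum>v \<in> ?V. if v \<in> {x, p x} then g v else 0)"
    by (rule sum.swap)
  also have "\<dots> = (\<Sum>x \<in> ?A. g x + g (p x))"
  proof (rule sum.cong[OF refl])
    fix x assume x: "x \<in> ?A"
    have "(\<Sum>v \<in> ?V. if v \<in> {x, p x} then g v else 0) = sum g (?V \<inter> {x, p x})"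
      using fin by (simp add: sum.If_cases Int_def)
    also have "?V \<inter> {x, p x} = {x, p x}" using x pr by auto
    also have "sum g {x, p x} = g x + g (p x)"
      using pr[OF x] by (cases "x = p x") auto
    finally show "(\<Sum>v \<in> ?V. if v \<in> {x, p x} then g v else 0) = g x + g (p x)" .
  qed
  finally show ?thesis .
qed

lemma parent_tree_xi:
  assumes "parent_tree G c p d"
  shows "xi_ce G = (\<Sum>x \<in> vertices G - {c}. 1 / real (eccentricity G x) + 1 / real (eccentricity G (p x)))"
  using parent_tree_degree_sum[OF assms, of "\<lambda>v. 1 / real (eccentricity G v)"]
  by (simp add: xi_ce_def)

text \<open>The parent edges number one less than the vertices, so a forest has no room for other edges.\<close>

lemma tree_parents:
  assumes "is_tree G" "z \<in> vertices G"
  obtains p where "parent_tree G z p (\<lambda>x. graph_dist G x z)"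
    and "\<And>x. x \<in> vertices G - {z} \<Longrightarrow> graph_dist G x z = Suc (graph_dist G (p x) z)"
proof -
  let ?V = "vertices G" and ?d = "\<lambda>x. graph_dist G x z"
  have s: "simple_graph G" and c: "connected_graph G" and a: "\<nexists>p. is_cycle G p"
    using assms(1) unfolding is_tree_def by auto
  have fin: "finite ?V" using s by (simp add: simple_graph_def)
  \<comment> \<open>The second vertex of a shortest walk to \<open>z\<close> serves as
    parent.\<close>
  have "\<exists>w. {x, w} \<in> edges G \<and> w \<in> ?V \<and> ?d x = Suc (?d w)" if x: "x \<in> ?V - {z}" for x
  proof -
    have r: "reach G x (?d x) z" using connected_reach[OF c] x assms(2) by blast
    have "?d x \<noteq> 0" using graph_dist_pos[OF r] x by simp
    then obtain k where k: "?d x = Suc k" by (cases "?d x") auto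
    then obtain w where w: "{x, w} \<in> edges G" "reach G w k z" using r reach_SucD by metis
    have wV: "w \<in> ?V" using s w(1) unfolding simple_graph_def by auto
    have "?d w \<le> k" using w(2) by (rule graph_dist_le)
    moreover have "?d x \<le> Suc (?d w)" using graph_dist_step[OF c w(1)] x wV assms(2) by blast
    ultimately show ?thesis using k w(1) wV by auto
  qed
  then obtain p where p: "\<And>x. x \<in> ?V - {z} \<Longrightarrow> {x, p x} \<in> edges G \<and> p x \<in> ?V \<and> ?d x = Suc (?d (p x))"
    by metis
  let ?I = "(\<lambda>x. {x, p x}) ` (?V - {z})"
  have "inj_on (\<lambda>x. {x, p x}) (?V - {z})"
    using parent_edges_inj[of "?V - {z}" ?d p] p by simp
  then have "card ?I = card ?V - 1" using assms(2) fin by (simp add: card_image)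
  moreover have "?I \<subseteq> edges G" using p by auto
  moreover have "card (edges G) < card ?V" using card_edges_forest[OF s _ a] assms(2) by blast
  ultimately have "?I = edges G" by (intro card_seteq finite_edges s) auto
  then have "parent_tree G z p ?d"
    unfolding parent_tree_def using fin assms(2) p by simp
  then show ?thesis using that p by blast
qed

section \<open>Eccentricities and the center of a tree\<close>

text \<open>Every edge joins a vertex to its parent with respect to the root \<open>z\<close>, and
  the parent is strictly closer to \<open>z\<close>.\<close>

lemma tree_adjacent_dist_neq:
  assumes "is_tree G" "{u, v} \<in> edges G" "z \<in> vertices G"
  shows "graph_dist G u z \<noteq> graph_dist G v z"
proof -
  obtain p where p: "parent_tree G z p (\<lambda>x. graph_dist G x z)"
    using tree_parents[OF assms(1,3)] by blast
  then have "{u, v} \<in> (\<lambda>x. {x, p x}) ` (vertices G - {z})"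
    using assms(2) unfolding parent_tree_def by simp
  then obtain x where x: "x \<in> vertices G - {z}" "{u, v} = {x, p x}" by blast
  then have "graph_dist G (p x) z < graph_dist G x z"
    using p unfolding parent_tree_def by auto
  then show ?thesis using x(2) by (auto simp: doubleton_eq_iff)
qed

text \<open>Let \<open>z\<close> be farthest from \<open>v\<close>. At most one neighbour of
  \<open>v\<close>, its parent with respect to the root \<open>z\<close>, is not farther from
  \<open>z\<close> than \<open>v\<close>, so \<open>u\<close> or \<open>w\<close> is
  farther.\<close>

lemma tree_ecc_convex:
  assumes "is_tree G" "{u, v} \<in> edges G" "{w, v} \<in> edges G" "u \<noteq> w"
  shows "eccentricity G v < max (eccentricity G u) (eccentricity G w)"
proof -
  have s: "simple_graph G" and c: "connected_graph G"
    using assms(1) unfolding is_tree_def by auto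
  have fin: "finite (vertices G)" and ne: "vertices G \<noteq> {}"
    using s c by (auto simp: simple_graph_def connected_graph_def)
  obtain z where z: "z \<in> vertices G" "graph_dist G v z = eccentricity G v"
    using ecc_attained[OF fin ne] by blast
  obtain p where p: "parent_tree G z p (\<lambda>x. graph_dist G x z)"
    using tree_parents[OF assms(1) z(1)] by blast
  have alt: "y = p v \<or> graph_dist G v z < graph_dist G y z" if "{y, v} \<in> edges G" for y
  proof -
    have "{y, v} \<in> (\<lambda>x. {x, p x}) ` (vertices G - {z})"
      using that p unfolding parent_tree_def by simp
    then obtain x where "x \<in> vertices G - {z}" "{y, v} = {x, p x}" by blast
    then show ?thesis using p unfolding parent_tree_def by (auto simp: doubleton_eq_iff)
  qed
  then have "graph_dist G v z < graph_dist G u z \<or> graph_dist G v z < graph_dist G w z"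
    using assms(2-4) by metis
  then show ?thesis
    using z graph_dist_le_ecc[OF fin z(1), of u] graph_dist_le_ecc[OF fin z(1), of w] by linarith
qed

lemma ecc_step:
  assumes "simple_graph G" "connected_graph G" "{u, v} \<in> edges G"
  shows "eccentricity G u \<le> Suc (eccentricity G v)"
proof (rule ecc_le)
  show fin: "finite (vertices G)" "vertices G \<noteq> {}"
    using assms by (auto simp: simple_graph_def connected_graph_def)
  fix z assume z: "z \<in> vertices G"
  have "u \<in> vertices G" "v \<in> vertices G" using assms unfolding simple_graph_def by auto
  then show "graph_dist G u z \<le> Suc (eccentricity G v)"
    using graph_dist_step[OF assms(2,3) _ _ z] graph_dist_le_ecc[OF fin(1) z, of v]
    by (meson Suc_le_mono le_trans)
qed

lemma ecc_pos:
  assumes "finite (vertices G)" "reach G u k v" "v \<in> vertices G" "u \<noteq> v"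
  shows "0 < eccentricity G u"
  using graph_dist_pos[OF assms(2,4)] graph_dist_le_ecc[OF assms(1,3), of u] by linarith

lemma ecc_reach:
  assumes "simple_graph G" "connected_graph G" "reach G u k v"
  shows "eccentricity G u \<le> eccentricity G v + k"
  using assms(3)
proof (induction k arbitrary: u)
  case 0
  then show ?case using reach_0D by fastforce
next
  case (Suc k)
  then obtain w where "{u, w} \<in> edges G" "reach G w k v" using reach_SucD by metis
  then show ?case using ecc_step[OF assms(1,2)] Suc.IH by fastforce
qed

text \<open>Let \<open>c\<close> have minimum eccentricity. By convexity, eccentricity falls by one
  with each step towards \<open>c\<close> until the center is reached. The number \<open>m\<close>
  bounds the distance to the center: it is \<open>\<rho>\<close> for one central vertex and
  \<open>\<rho> - 1\<close> for two, and \<open>Suc \<rho> = m + s\<close> covers both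
  cases.\<close>

lemma tree_center:
  assumes "is_tree G" "2 \<le> card (vertices G)"
  obtains c p d s m \<rho> where "parent_tree G c p d" "s \<in> {1, 2}" "0 < \<rho>" "Suc \<rho> = m + s"
    "card {x \<in> vertices G. eccentricity G x = \<rho>} = s"
    "eccentricity G c = \<rho>"
    "\<And>x. x \<in> vertices G \<Longrightarrow> \<rho> \<le> eccentricity G x \<and> eccentricity G x \<le> \<rho> + m"
    "\<And>x. x \<in> vertices G - {c} \<Longrightarrow>
       eccentricity G (p x) = (if eccentricity G x = \<rho> then \<rho> else eccentricity G x - 1)"
proof -
  let ?V = "vertices G" and ?e = "eccentricity G"
  have s: "simple_graph G" and con: "connected_graph G"
    using assms(1) unfolding is_tree_def by auto
  have fin: "finite ?V" and ne: "?V \<noteq> {}"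
    using s con by (auto simp: simple_graph_def connected_graph_def)
  define \<rho> where "\<rho> = Min (?e ` ?V)"
  have rho_le: "\<rho> \<le> ?e x" if "x \<in> ?V" for x
    unfolding \<rho>_def using fin that by auto
  have "\<rho> \<in> ?e ` ?V" unfolding \<rho>_def using fin ne by (intro Min_in) auto
  then obtain c where c: "c \<in> ?V" "?e c = \<rho>" by auto
  obtain p where pt: "parent_tree G c p (\<lambda>x. graph_dist G x c)"
    and pd: "\<And>x. x \<in> ?V - {c} \<Longrightarrow> graph_dist G x c = Suc (graph_dist G (p x) c)"
    using tree_parents[OF assms(1) c(1)] by blast
  have pV: "p x \<in> ?V" and pE: "{x, p x} \<in> edges G" if "x \<in> ?V - {c}" for x
    using pt that unfolding parent_tree_def by auto
  have "\<exists>v \<in> ?V. v \<noteq> c" using assms(2) c(1) fin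
    by (metis card_le_Suc0_iff_eq not_less_eq_eq numeral_2_eq_2)
  then have rho_pos: "0 < \<rho>"
    using ecc_pos[OF fin connected_reach[OF con c(1)]] c by metis
  \<comment> \<open>By induction, or because it is \<open>c\<close>, the vertex
    \<open>p (p y)\<close> has eccentricity at most that of \<open>p y\<close>. Convexity at
    \<open>p y\<close> then forces a drop from \<open>y\<close> to \<open>p y\<close>.\<close>
  have desc: "?e (p y) < ?e y \<or> p y = c" if "y \<in> ?V - {c}" for y
    using that
  proof (induction "graph_dist G y c" arbitrary: y rule: less_induct)
    case less
    show ?case
    proof (cases "p y = c")
      case False
      then have py: "p y \<in> ?V - {c}" using pV less.prems by blast
      have d: "graph_dist G (p y) c < graph_dist G y c" using pd[OF less.prems] by simp
      have "y \<noteq> p (p y)" using pd[OF less.prems] pd[OF py] by fastforce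
      moreover have "{p (p y), p y} \<in> edges G" using pE[OF py] by (simp add: insert_commute)
      ultimately have cv: "?e (p y) < max (?e y) (?e (p (p y)))"
        using tree_ecc_convex[OF assms(1) pE[OF less.prems]] by blast
      have "?e (p (p y)) \<le> ?e (p y)"
        using less.hyps[OF d py] c rho_le[of "p y"] py by auto
      then show ?thesis using cv by linarith
    qed simp
  qed
  have step: "?e (p x) = (if ?e x = \<rho> then \<rho> else ?e x - 1)" and toc: "?e x = \<rho> \<Longrightarrow> p x = c"
    if "x \<in> ?V - {c}" for x
  proof -
    have le: "?e x \<le> Suc (?e (p x))" using ecc_step[OF s con pE[OF that]] .
    have ge: "\<rho> \<le> ?e (p x)" "\<rho> \<le> ?e x" using rho_le pV that by auto
    show "?e (p x) = (if ?e x = \<rho> then \<rho> else ?e x - 1)"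
      using le ge desc[OF that] c(2) by auto
    show "?e x = \<rho> \<Longrightarrow> p x = c" using desc[OF that] ge by auto
  qed
  let ?C = "{x \<in> ?V. ?e x = \<rho>}"
  have depth: "?e x \<le> ?e y + graph_dist G x y" if "x \<in> ?V" "y \<in> ?V" for x y
    using ecc_reach[OF s con connected_reach[OF con that]] .
  have dc: "graph_dist G x y \<le> \<rho>" if "x \<in> ?V" "y \<in> ?V" "?e y = \<rho>" for x y
    using graph_dist_le_ecc[OF fin that(1), of y] graph_dist_sym[OF con that(1,2)] that by simp
  \<comment> \<open>Two central vertices besides \<open>c\<close> would both be adjacent to
    \<open>c\<close>, and convexity at \<open>c\<close> would push its eccentricity below
    \<open>\<rho>\<close>.\<close>
  have two: "x = y" if "x \<in> ?C - {c}" "y \<in> ?C - {c}" for x y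
  proof (rule ccontr)
    assume "x \<noteq> y"
    have "{x, c} \<in> edges G" "{y, c} \<in> edges G"
      using pE[of x] pE[of y] toc[of x] toc[of y] that by auto
    then show False using tree_ecc_convex[OF assms(1) _ _ \<open>x \<noteq> y\<close>] c that by fastforce
  qed
  show ?thesis
  proof (cases "?C - {c} = {}")
    case True
    then have "?C = {c}" using c by auto
    then have "card ?C = 1" by simp
    moreover have "\<And>x. x \<in> ?V \<Longrightarrow> \<rho> \<le> ?e x \<and> ?e x \<le> \<rho> + \<rho>"
      using rho_le depth[OF _ c(1)] dc[OF _ c] c(2) by (metis add_left_mono le_trans)
    ultimately show ?thesis
      using that[OF pt, of 1 \<rho> \<rho>] rho_pos c step by simp
  next
    case False
    then obtain c' where c': "c' \<in> ?C - {c}" by blast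
    have "?C - {c} = {c'}" using two c' by blast
    then have "?C = {c, c'}" using c by blast
    moreover have "c \<noteq> c'" using c' by blast
    ultimately have "card ?C = 2" by simp
    \<comment> \<open>The distances from \<open>x\<close> to the adjacent vertices \<open>c\<close>
      and \<open>c'\<close> differ and are at most \<open>\<rho>\<close>, so one of them is at most
      \<open>\<rho> - 1\<close>.\<close>
    moreover have "\<rho> \<le> ?e x \<and> ?e x \<le> \<rho> + (\<rho> - 1)" if x: "x \<in> ?V" for x
    proof -
      have edge: "{c', c} \<in> edges G" using pE[of c'] toc[of c'] c' by auto
      have "graph_dist G c' x \<noteq> graph_dist G c x"
        using tree_adjacent_dist_neq[OF assms(1) edge x] .
      then have neq: "graph_dist G x c' \<noteq> graph_dist G x c"
        using graph_dist_sym[OF con x] c c' by auto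
      then have "graph_dist G x c \<le> \<rho> - 1 \<or> graph_dist G x c' \<le> \<rho> - 1"
        using dc[OF x c] dc[OF x, of c'] c' by fastforce
      then show ?thesis using depth[OF x, of c] depth[OF x, of c'] rho_le[OF x] c c' by auto
    qed
    ultimately show ?thesis
      using that[OF pt, of 2 \<rho> "\<rho> - 1"] rho_pos c step by simp
  qed
qed

section \<open>Growth of balls around the center\<close>

lemma tree_degree_pos:
  assumes "is_tree G" "2 \<le> card (vertices G)" "v \<in> vertices G"
  shows "0 < vertex_degree G v"
proof -
  have s: "simple_graph G" using assms(1) unfolding is_tree_def by auto
  have fin: "finite (vertices G)" using s by (simp add: simple_graph_def)
  obtain z where z: "z \<in> vertices G" "z \<noteq> v" using assms(2,3) fin
    by (metis card_le_Suc0_iff_eq not_less_eq_eq numeral_2_eq_2)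
  obtain p where "parent_tree G z p (\<lambda>x. graph_dist G x z)"
    using tree_parents[OF assms(1) z(1)] by blast
  then have "{v, p v} \<in> {e \<in> edges G. v \<in> e}"
    using assms(3) z unfolding parent_tree_def by auto
  then show ?thesis unfolding vertex_degree_def
    using finite_edges[OF s] by (auto simp: card_gt_0_iff)
qed

text \<open>Exactly the branching vertices have nonnegative degree minus 3, so the sum of these
  excesses over \<open>A\<close> is at most their sum over the branching vertices. With
  \<open>n\<close> vertices, \<open>r\<close> of them branching, the degrees add up to
  \<open>2 * (n - 1)\<close>; the other vertices take at least 1 each, which leaves at most
  \<open>n + r - 2\<close> for the branching ones.\<close>

lemma tree_degree_excess:
  assumes "is_tree G" "2 \<le> card (vertices G)" "A \<subseteq> vertices G"
  shows "(\<Sum>v \<in> A. real (vertex_degree G v)) + 2 * card (branching_vertices G) + 2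
     \<le> 3 * real (card A) + card (vertices G)"
proof -
  let ?V = "vertices G" and ?B = "branching_vertices G" and ?d = "\<lambda>v. real (vertex_degree G v)"
  have fin: "finite ?V" using assms(1) unfolding is_tree_def simple_graph_def by auto
  have BV: "?B \<subseteq> ?V" unfolding branching_vertices_def by auto
  note f = finite_subset[OF assms(3) fin] finite_subset[OF BV fin]
  obtain c where c: "c \<in> ?V" using assms(2) by fastforce
  obtain p where "parent_tree G c p (\<lambda>x. graph_dist G x c)"
    using tree_parents[OF assms(1) c] by blast
  from parent_tree_degree_sum[OF this, of "\<lambda>_. 1"]
  have total: "(\<Sum>v \<in> ?V. ?d v) = 2 * (real (card ?V) - 1)"
    using c assms(2) by (simp add: of_nat_diff)
  have "(\<Sum>v \<in> A. ?d v - 3) \<le> (\<Sum>v \<in> A. if v \<in> ?B then ?d v - 3 else 0)"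
    using assms(3) by (intro sum_mono) (auto simp: branching_vertices_def)
  also have "\<dots> = (\<Sum>v \<in> A \<inter> ?B. ?d v - 3)"
    using f(1) by (simp add: sum.inter_restrict)
  also have "\<dots> \<le> (\<Sum>v \<in> ?B. ?d v - 3)"
    using f by (intro sum_mono2) (auto simp: branching_vertices_def)
  finally have 1: "(\<Sum>v \<in> A. ?d v) - 3 * card A \<le> (\<Sum>v \<in> ?B. ?d v) - 3 * card ?B"
    by (simp add: sum_subtractf)
  have "(\<Sum>v \<in> ?V - ?B. 1) \<le> (\<Sum>v \<in> ?V - ?B. ?d v)"
    using tree_degree_pos[OF assms(1,2)] by (intro sum_mono) (auto simp: Suc_le_eq)
  then have "real (card ?V) - card ?B \<le> (\<Sum>v \<in> ?V - ?B. ?d v)"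
    using BV f fin by (simp add: card_Diff_subset card_mono of_nat_diff)
  moreover have "(\<Sum>v \<in> ?V. ?d v) = (\<Sum>v \<in> ?V - ?B. ?d v) + (\<Sum>v \<in> ?B. ?d v)"
    using BV fin by (rule sum.subset_diff)
  ultimately show ?thesis using 1 total by simp
qed

text \<open>With \<open>b = n - 2 * r\<close>, the upper bound for a ball of radius \<open>j\<close>
  around a center of size \<open>s\<close>; in closed form
  \<open>2 ^ j * (s + b) - b\<close>.\<close>

fun ball_bound :: "nat \<Rightarrow> nat \<Rightarrow> nat \<Rightarrow> nat" where
  "ball_bound s b 0 = s"
| "ball_bound s b (Suc j) = 2 * ball_bound s b j + b"

text \<open>
  The weight of the edge from a vertex at distance \<open>k\<close> from the center to its parent, in a
  tree of radius \<open>\<rho>\<close>. The truncated subtraction yields the weight of the edge joining two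
  centers for \<open>k = 0\<close>.
\<close>

definition edge_weight :: "nat \<Rightarrow> nat \<Rightarrow> real" where
  "edge_weight \<rho> k = 1 / real (\<rho> + k) + 1 / real (\<rho> + (k - 1))"

lemma edge_weight_antimono: "0 < \<rho> \<Longrightarrow> antimono (edge_weight \<rho>)"
  unfolding edge_weight_def
  by (intro antimonoI add_mono divide_left_mono) auto

text \<open>Collects all that the comparison needs to know about the tree. The last bound is strict
  because \<open>c\<close> is left out of the count.\<close>

lemma tree_xi_shape:
  assumes "is_tree G" "card (vertices G) = n" "2 \<le> n" "card (branching_vertices G) = r" "2 * r + 2 \<le> n"
  obtains c s m \<rho> where "c \<in> vertices G" "s \<in> {1, 2}" "0 < \<rho>" "Suc \<rho> = m + s"
    "n \<le> ball_bound s (n - 2 * r) m"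
    "xi_ce G = (\<Sum>x \<in> vertices G - {c}. edge_weight \<rho> (eccentricity G x - \<rho>))"
    "\<And>j. card {x \<in> vertices G - {c}. eccentricity G x - \<rho> \<le> j} < ball_bound s (n - 2 * r) j"
proof -
  let ?V = "vertices G" and ?e = "eccentricity G" and ?f = "ball_bound"
  have fin: "finite ?V" using assms(1) unfolding is_tree_def simple_graph_def by auto
  obtain c p d s m \<rho> where pt: "parent_tree G c p d" and s: "s \<in> {1, 2}" and rho: "0 < \<rho>" "Suc \<rho> = m + s"
    and cs: "card {x \<in> ?V. ?e x = \<rho>} = s" and ec: "?e c = \<rho>"
    and e: "\<And>x. x \<in> ?V \<Longrightarrow> \<rho> \<le> ?e x \<and> ?e x \<le> \<rho> + m"
    and ep: "\<And>x. x \<in> ?V - {c} \<Longrightarrow> ?e (p x) = (if ?e x = \<rho> then \<rho> else ?e x - 1)"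
    by (rule tree_center[OF assms(1)]) (use assms(2,3) in simp, rule that)
  have c: "c \<in> ?V" using pt unfolding parent_tree_def by auto
  define ball where "ball j = {x \<in> ?V. ?e x \<le> \<rho> + j}" for j
  have fb: "finite (ball j)" and bV: "ball j \<subseteq> ?V" and cb: "c \<in> ball j" for j
    using fin c ec by (auto simp: ball_def)
  \<comment> \<open>The degree sum over a ball counts the edges by their ends in it. A vertex of the
    next ball other than \<open>c\<close> has its parent in this ball, so the sum is at least the
    two ball sizes minus 2; \<open>tree_degree_excess\<close> bounds it from above.\<close>
  have grow: "card (ball (Suc j)) \<le> 2 * card (ball j) + (n - 2 * r)" for j
  proof -
    have ind: "(\<Sum>v \<in> A. if v \<in> ball i then 1 else 0) = real (card (A \<inter> ball i))" if "finite A" for A i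
      using that by (simp add: sum.If_cases Int_def)
    have "(\<Sum>v \<in> ball j. real (vertex_degree G v))
        = (\<Sum>v \<in> ?V. real (vertex_degree G v) * (if v \<in> ball j then 1 else 0))"
    proof -
      have "(\<Sum>v \<in> ?V. real (vertex_degree G v) * (if v \<in> ball j then 1 else 0))
          = (\<Sum>v \<in> ?V. if v \<in> ball j then real (vertex_degree G v) else 0)"
        by (intro sum.cong) auto
      then show ?thesis using fin bV[of j] by (simp add: sum.If_cases Int_absorb1)
    qed
    also have "\<dots> = (\<Sum>x \<in> ?V - {c}. (if x \<in> ball j then 1 else 0) + (if p x \<in> ball j then 1 else 0))"
      by (rule parent_tree_degree_sum[OF pt])
    also have "\<dots> \<ge> (\<Sum>x \<in> ?V - {c}. (if x \<in> ball j then 1 else 0) + (if x \<in> ball (Suc j) then 1 else 0))"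
    proof (rule sum_mono)
      fix x assume x: "x \<in> ?V - {c}"
      have "p x \<in> ?V" using pt x unfolding parent_tree_def by auto
      then have "x \<in> ball (Suc j) \<Longrightarrow> p x \<in> ball j"
        using ep[OF x] by (auto simp: ball_def split: if_splits)
      then show "(if x \<in> ball j then 1 else 0) + (if x \<in> ball (Suc j) then 1 else 0)
          \<le> (if x \<in> ball j then 1 else 0) + (if p x \<in> ball j then 1 else (0::real))" by auto
    qed
    also have "(\<Sum>x \<in> ?V - {c}. (if x \<in> ball j then 1 else 0) + (if x \<in> ball (Suc j) then 1 else 0))
        = real (card (ball j - {c})) + real (card (ball (Suc j) - {c}))"
    proof -
      have "(?V - {c}) \<inter> ball i = ball i - {c}" for i using bV by auto
      then show ?thesis using fin by (simp add: sum.distrib ind)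
    qed
    finally have "real (card (ball j - {c})) + real (card (ball (Suc j) - {c}))
        \<le> (\<Sum>v \<in> ball j. real (vertex_degree G v))" .
    moreover have "(\<Sum>v \<in> ball j. real (vertex_degree G v)) + 2 * r + 2 \<le> 3 * real (card (ball j)) + n"
      using tree_degree_excess[OF assms(1) _ bV, of j] assms by simp
    moreover have "card (ball i) = Suc (card (ball i - {c}))" for i
      using card_Suc_Diff1[OF fb cb] by simp
    ultimately have "real (card (ball (Suc j))) \<le> 2 * real (card (ball j)) + (real n - 2 * r)" by simp
    also have "real n - 2 * r = real (n - 2 * r)" using assms(5) by (simp add: of_nat_diff)
    finally show ?thesis by linarith
  qed
  have ball: "card (ball j) \<le> ?f s (n - 2 * r) j" for j
  proof (induction j)
    case 0
    have "ball 0 = {x \<in> ?V. ?e x = \<rho>}" using e by (force simp: ball_def)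
    then show ?case using cs by simp
  next
    case (Suc j)
    then show ?case using grow[of j] by simp
  qed
  \<comment> \<open>No vertex is farther than \<open>m\<close> from the center, so the bound for
    radius \<open>m\<close> must reach \<open>n\<close>.\<close>
  have "ball m = ?V" using e by (auto simp: ball_def)
  then have n: "n \<le> ?f s (n - 2 * r) m" using ball[of m] assms(2) by simp
  have "xi_ce G = (\<Sum>x \<in> ?V - {c}. edge_weight \<rho> (?e x - \<rho>))"
    unfolding parent_tree_xi[OF pt]
  proof (rule sum.cong[OF refl])
    fix x assume x: "x \<in> ?V - {c}"
    \<comment> \<open>If \<open>x\<close> is the second central vertex, both ends have eccentricity
      \<open>\<rho>\<close>, in agreement with the truncated \<open>0 - 1\<close>.\<close>
    show "1 / real (?e x) + 1 / real (?e (p x)) = edge_weight \<rho> (?e x - \<rho>)"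
      using ep[OF x] e[of x] x rho unfolding edge_weight_def by (auto simp: of_nat_diff)
  qed
  moreover have "card {x \<in> ?V - {c}. ?e x - \<rho> \<le> j} < ?f s (n - 2 * r) j" for j
  proof -
    have "{x \<in> ?V - {c}. ?e x - \<rho> \<le> j} = ball j - {c}" using e by (auto simp: ball_def)
    then show ?thesis using ball[of j] card_Diff1_less[OF fb cb, of j] by simp
  qed
  ultimately show ?thesis using that c s rho n by blast
qed

section \<open>Comparing sums of a decreasing function by counting\<close>

text \<open>Summation by parts: \<open>h i\<close> is \<open>h K\<close> plus the drops of
  \<open>h\<close> between \<open>i\<close> and \<open>K\<close>, so the sum depends on
  \<open>g\<close> only through the cumulative counts.\<close>

lemma sum_by_layers:
  fixes h :: "nat \<Rightarrow> real"
  assumes "finite Z" "\<And>x. x \<in> Z \<Longrightarrow> g x \<le> K"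
  shows "(\<Sum>x \<in> Z. h (g x)) = real (card Z) * h K
    + (\<Sum>k<K. real (card {x \<in> Z. g x \<le> k}) * (h k - h (Suc k)))"
proof -
  have tel: "h i = h K + (\<Sum>k<K. if i \<le> k then h k - h (Suc k) else 0)" if "i \<le> K" for i
    using that
  proof (induction K rule: dec_induct)
    case base
    then show ?case by simp
  qed simp
  have "(\<Sum>x \<in> Z. h (g x)) = (\<Sum>x \<in> Z. h K + (\<Sum>k<K. if g x \<le> k then h k - h (Suc k) else 0))"
    using assms(2) by (intro sum.cong refl tel)
  also have "\<dots> = real (card Z) * h K + (\<Sum>x \<in> Z. \<Sum>k<K. if g x \<le> k then h k - h (Suc k) else 0)"
    by (simp add: sum.distrib)
  also have "(\<Sum>x \<in> Z. \<Sum>k<K. if g x \<le> k then h k - h (Suc k) else 0)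
      = (\<Sum>k<K. \<Sum>x \<in> Z. if g x \<le> k then h k - h (Suc k) else 0)"
    by (rule sum.swap)
  also have "\<dots> = (\<Sum>k<K. real (card {x \<in> Z. g x \<le> k}) * (h k - h (Suc k)))"
    using assms(1) by (simp add: sum.If_cases Int_def)
  finally show ?thesis .
qed

text \<open>In the layered form the counts are multiplied by the drops of \<open>h\<close>, which
  are nonnegative, so larger counts give the larger sum.\<close>

lemma sum_antimono_le:
  fixes h :: "nat \<Rightarrow> real"
  assumes "finite X" "finite Y" "card X = card Y" "antimono h"
    and cnt: "\<And>j. card {x \<in> X. a x \<le> j} \<le> card {y \<in> Y. b y \<le> j}"
  shows "(\<Sum>x \<in> X. h (a x)) \<le> (\<Sum>y \<in> Y. h (b y))"
proof -
  \<comment> \<open>A common bound for both sides; the inserted 0 covers empty sets.\<close>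
  define K where "K = Max (insert 0 (a ` X \<union> b ` Y))"
  have K: "\<And>x. x \<in> X \<Longrightarrow> a x \<le> K" "\<And>y. y \<in> Y \<Longrightarrow> b y \<le> K"
    unfolding K_def using assms(1,2) by auto
  show ?thesis
    unfolding sum_by_layers[of X a K h, OF assms(1) K(1), simplified]
      sum_by_layers[of Y b K h, OF assms(2) K(2), simplified] assms(3)
    using cnt antimonoD[OF assms(4)]
    by (intro add_left_mono sum_mono mult_right_mono) auto
qed

section \<open>Ranks of the numbers with respect to the ball bounds\<close>

text \<open>Plays the part of the distance from vertex \<open>w\<close> of \<open>B(n, r)\<close> to
  the set of the first \<open>s\<close> vertices, as if the ball of radius \<open>j\<close>
  consisted of the first \<open>ball_bound s b j\<close> numbers.\<close>

definition ball_rank :: "nat \<Rightarrow> nat \<Rightarrow> nat \<Rightarrow> nat" where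
  "ball_rank s b w = (LEAST j. w < ball_bound s b j)"

lemma ball_bound_pos: "1 \<le> s \<Longrightarrow> 1 \<le> ball_bound s b j"
  by (induction j) auto

lemma ball_bound_strict_mono: "1 \<le> s \<Longrightarrow> strict_mono (ball_bound s b)"
  unfolding strict_mono_Suc_iff using ball_bound_pos[of s b] by (simp add: Suc_le_eq trans_less_add1)

lemma ball_rank_le_iff:
  assumes "1 \<le> s"
  shows "ball_rank s b w \<le> j \<longleftrightarrow> w < ball_bound s b j"
proof
  note mono = ball_bound_strict_mono[OF assms, of b]
  \<comment> \<open>The bounds are strictly increasing, so the one at \<open>Suc w\<close> exceeds
    \<open>w\<close> and the least index exists.\<close>
  have "w \<le> ball_bound s b w"
    using mono by (rule strict_mono_imp_increasing)
  also have "\<dots> < ball_bound s b (Suc w)"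
    using mono by (rule strict_monoD) simp
  finally have "w < ball_bound s b (ball_rank s b w)"
    unfolding ball_rank_def by (rule LeastI)
  then show "w < ball_bound s b j" if "ball_rank s b w \<le> j"
    using strict_mono_less_eq[OF mono] that by (meson order_less_le_trans)
  show "ball_rank s b w \<le> j" if "w < ball_bound s b j"
    unfolding ball_rank_def using that by (rule Least_le)
qed

section \<open>The tree \<open>B(n, r)\<close>\<close>

lemma level_start_mono: "level_start ds h \<le> level_start ds (Suc h)"
  by (cases h) auto

text \<open>The vertices up to level \<open>h\<close> are the root and the children of all vertices
  in earlier levels.\<close>

lemma level_start_Suc: "level_start ds (Suc h) = Suc (\<Sum>u<level_start ds h. down_degree ds u)"
proof (induction h)
  case (Suc h)
  have "(\<Sum>u<level_start ds (Suc h). down_degree ds u)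
      = (\<Sum>u<level_start ds h. down_degree ds u)
        + (\<Sum>u = level_start ds h..<level_start ds (Suc h). down_degree ds u)"
    using sum.atLeastLessThan_concat[OF le0 level_start_mono, of "down_degree ds" ds h]
    by (simp add: lessThan_atLeast0 del: level_start.simps)
  then show ?case using Suc by simp
qed simp

text \<open>The children of \<open>v\<close> come right after the root and the children of all
  vertices before \<open>v\<close>; the level no longer matters.\<close>

lemma first_free_eq:
  assumes "level_start ds h \<le> v"
  shows "first_free ds h v = Suc (\<Sum>u<v. down_degree ds u)"
proof -
  have "(\<Sum>u<v. down_degree ds u)
      = (\<Sum>u<level_start ds h. down_degree ds u) + (\<Sum>u = level_start ds h..<v. down_degree ds u)"
    using sum.atLeastLessThan_concat[OF le0 assms, of "down_degree ds"]
    by (simp add: lessThan_atLeast0 del: level_start.simps)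
  then show ?thesis by (simp add: first_free_def level_start_Suc del: level_start.simps)
qed

definition B_degrees :: "nat \<Rightarrow> nat \<Rightarrow> nat list" where
  "B_degrees n r = (n - 2 * r + 1) # replicate (r - 1) 3 @ replicate (n - r) 1"

text \<open>The root has the children 1 to \<open>n - 2 * r + 1\<close>; a vertex \<open>v\<close>
  with \<open>1 \<le> v < r\<close> has the two children \<open>n - 2 * r + 2 * v\<close> and its
  successor, whence the division by 2.\<close>

definition B_parent :: "nat \<Rightarrow> nat \<Rightarrow> nat \<Rightarrow> nat" where
  "B_parent n r w = (if w \<le> n - 2 * r + 1 then 0 else (w - (n - 2 * r)) div 2)"

context
  fixes n r :: nat
  assumes r: "1 \<le> r" and nr: "2 * r + 2 \<le> n"
begin

lemma B_down_degree:
  "v < n \<Longrightarrow> down_degree (B_degrees n r) v = (if v = 0 then n - 2 * r + 1 else if v < r then 2 else 0)"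
  using r nr unfolding down_degree_def B_degrees_def
  by (auto simp: nth_append nth_Cons split: nat.split)

text \<open>The number of the first child of \<open>v\<close>. Vertices from \<open>r\<close> on are
  leaves, so the value stays at \<open>n\<close> there.\<close>

lemma B_start:
  "v \<le> n \<Longrightarrow> Suc (\<Sum>u<v. down_degree (B_degrees n r) u) = (if v = 0 then 1 else n - 2 * r + 2 * min v r)"
proof (induction v)
  case (Suc v)
  define b where "b = n - 2 * r"
  show ?case
    using Suc r B_down_degree[of v] unfolding b_def[symmetric] by (auto simp: min_def)
qed simp

text \<open>Levels stay within the \<open>n\<close> vertices, and none is empty before all of them
  are used up; hence every vertex lies in some level.\<close>

lemma B_level_start_bounds:
  "level_start (B_degrees n r) h \<le> n \<and>
   (level_start (B_degrees n r) h < n \<longrightarrow> level_start (B_degrees n r) h < level_start (B_degrees n r) (Suc h))"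
proof -
  have le: "level_start (B_degrees n r) h \<le> n"
  proof (induction h)
    case (Suc h)
    then show ?case using r nr unfolding level_start_Suc B_start[OF Suc] by auto
  qed simp
  then show ?thesis using r nr unfolding level_start_Suc B_start[OF le] by auto
qed

lemma B_in_level:
  assumes "v < n"
  shows "\<exists>h. v \<in> greedy_level (B_degrees n r) h"
proof -
  let ?l = "level_start (B_degrees n r)"
  have "min h n \<le> ?l h" for h
  proof (induction h)
    case (Suc h)
    then show ?case using B_level_start_bounds[of h] B_level_start_bounds[of "Suc h"]
      level_start_mono[of "B_degrees n r" h] by linarith
  qed simp
  then have "v < ?l n" using assms by (metis min.idem order_less_le_trans)
  then have ex: "\<exists>h. v < ?l h" by blast
  define k where "k = (LEAST h. v < ?l h)"
  have k: "v < ?l k" unfolding k_def using ex by (rule LeastI_ex)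
  then obtain h where h: "k = Suc h" by (cases k) auto
  then have "\<not> v < ?l h" unfolding k_def using not_less_Least by (metis lessI)
  then show ?thesis using k h unfolding greedy_level_def
    by (intro exI[of _ h]) (simp del: level_start.simps)
qed

lemma B_vertices: "vertices (B_tree n r) = {..<n}"
  using r nr unfolding B_tree_def greedy_tree_def by auto

text \<open>The children of the vertices form consecutive intervals that partition the numbers from
  1 to \<open>n - 1\<close>, and \<open>B_parent\<close> names the interval containing
  \<open>w\<close>.\<close>

lemma B_edges: "edges (B_tree n r) = (\<lambda>w. {w, B_parent n r w}) ` {1..<n}"
proof -
  let ?ds = "B_degrees n r"
  let ?c = "\<lambda>v. Suc (\<Sum>u<v. down_degree ?ds u)"
  have E: "edges (B_tree n r) =
      {{v, w} | h v w. v \<in> greedy_level ?ds h \<and> w \<in> greedy_children ?ds h v}"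
    unfolding B_tree_def greedy_tree_def B_degrees_def by simp
  have child: "w \<in> greedy_children ?ds h v \<longleftrightarrow> ?c v \<le> w \<and> w < ?c (Suc v)"
    if "v \<in> greedy_level ?ds h" for h v w
    using that first_free_eq[of ?ds h v] unfolding greedy_level_def greedy_children_def by auto
  have lt: "v < n" if "v \<in> greedy_level ?ds h" for h v
    using that B_level_start_bounds[of "Suc h"] unfolding greedy_level_def by auto
  have par: "?c v \<le> w \<and> w < ?c (Suc v) \<longleftrightarrow> 1 \<le> w \<and> w < n \<and> v = B_parent n r w" if "v < n" for v w
  proof -
    have 1: "?c v = (if v = 0 then 1 else n - 2 * r + 2 * min v r)"
      using that by (intro B_start) simp
    have 2: "?c (Suc v) = n - 2 * r + 2 * min (Suc v) r"
      using that B_start[of "Suc v"] by simp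
    show ?thesis unfolding 1 2 B_parent_def using r nr that by (auto simp: min_def)
  qed
  show ?thesis
  proof (rule set_eqI)
    fix e
    show "e \<in> edges (B_tree n r) \<longleftrightarrow> e \<in> (\<lambda>w. {w, B_parent n r w}) ` {1..<n}"
    proof
      assume "e \<in> edges (B_tree n r)"
      then obtain h v w where "e = {v, w}" "v \<in> greedy_level ?ds h" "w \<in> greedy_children ?ds h v"
        unfolding E by blast
      then show "e \<in> (\<lambda>w. {w, B_parent n r w}) ` {1..<n}"
        using child lt par by (auto simp: insert_commute)
    next
      assume "e \<in> (\<lambda>w. {w, B_parent n r w}) ` {1..<n}"
      then obtain w where w: "e = {w, B_parent n r w}" "1 \<le> w" "w < n" by auto
      let ?v = "B_parent n r w"
      have v: "?v < n" using w unfolding B_parent_def by auto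
      obtain h where h: "?v \<in> greedy_level ?ds h" using B_in_level[OF v] by blast
      then have "w \<in> greedy_children ?ds h ?v" using child[OF h] par[OF v] w by blast
      then show "e \<in> edges (B_tree n r)" unfolding E using h w(1) by (auto simp: insert_commute)
    qed
  qed
qed

lemma B_parent_less: "1 \<le> w \<Longrightarrow> B_parent n r w < w"
  unfolding B_parent_def by auto

lemma B_parent_tree: "parent_tree (B_tree n r) 0 (B_parent n r) id"
proof -
  have V: "{..<n} - {0} = {1..<n}" by auto
  have p: "B_parent n r w < n \<and> B_parent n r w < w" if "w \<in> {1..<n}" for w
    using B_parent_less[of w] that by simp
  show ?thesis
    unfolding parent_tree_def B_edges B_vertices V using p nr by simp
qed

section \<open>Upper bounds for distances and eccentricities in \<open>B(n, r)\<close>\<close>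

text \<open>Passing to the parent undoes one step of the recursion: \<open>w < 2 * k + b\<close>
  gives \<open>(w - b) div 2 < k\<close>. The truncated form also covers \<open>w = 1\<close> with
  \<open>s = 2\<close>, where the rank is 0.\<close>

lemma B_rank_parent:
  assumes "s \<in> {1, 2}" "1 \<le> w"
  shows "ball_rank s (n - 2 * r) (B_parent n r w) \<le> ball_rank s (n - 2 * r) w - 1"
    and "s \<le> w \<Longrightarrow> ball_rank s (n - 2 * r) (B_parent n r w) < ball_rank s (n - 2 * r) w"
proof -
  have s: "1 \<le> s" using assms(1) by auto
  let ?k = "ball_rank s (n - 2 * r) w"
  have main: "ball_rank s (n - 2 * r) (B_parent n r w) \<le> j" if "?k = Suc j" for j
  proof -
    have "w < 2 * ball_bound s (n - 2 * r) j + (n - 2 * r)"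
      using ball_rank_le_iff[OF s, of "n - 2 * r" w "Suc j"] that by simp
    moreover have "1 \<le> ball_bound s (n - 2 * r) j" using s by (rule ball_bound_pos)
    ultimately show ?thesis unfolding ball_rank_le_iff[OF s] B_parent_def by auto
  qed
  have zero: "w < s" if "?k = 0" using ball_rank_le_iff[OF s, of "n - 2 * r" w 0] that by simp
  show "s \<le> w \<Longrightarrow> ball_rank s (n - 2 * r) (B_parent n r w) < ?k"
    using main zero by (cases ?k) (auto simp: less_Suc_eq_le)
  show "ball_rank s (n - 2 * r) (B_parent n r w) \<le> ?k - 1"
  proof (cases ?k)
    case 0
    then have "B_parent n r w < s" using zero B_parent_less[OF assms(2)] by linarith
    then show ?thesis using ball_rank_le_iff[OF s, of "n - 2 * r" "B_parent n r w" 0] by simp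
  qed (use main in auto)
qed

text \<open>Climb from \<open>w\<close> and \<open>z\<close> until both numbers are below
  \<open>s\<close>; each step lowers a rank. The summand \<open>s - 1\<close> pays for the edge
  between 0 and 1 if \<open>s = 2\<close>.\<close>

lemma B_reach:
  assumes "s \<in> {1, 2}" "w < n" "z < n"
  shows "\<exists>k \<le> ball_rank s (n - 2 * r) w + ball_rank s (n - 2 * r) z + (s - 1). reach (B_tree n r) w k z"
  using assms(2,3)
proof (induction "w + z" arbitrary: w z rule: less_induct)
  case less
  \<comment> \<open>Stated for \<open>x\<close> and \<open>y\<close> so that it serves for climbing
    from either end.\<close>
  have up: "\<exists>k \<le> ball_rank s (n - 2 * r) x + ball_rank s (n - 2 * r) y + (s - 1). reach (B_tree n r) x k y"
    if "s \<le> x" "x < n" "y < n" "x + y = w + z" for x y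
  proof -
    have x: "1 \<le> x" using that assms(1) by auto
    have p: "B_parent n r x < x" using B_parent_less[OF x] .
    have "\<exists>k \<le> ball_rank s (n - 2 * r) (B_parent n r x) + ball_rank s (n - 2 * r) y + (s - 1).
        reach (B_tree n r) (B_parent n r x) k y"
      using p that by (intro less.hyps) auto
    then obtain k where k: "k \<le> ball_rank s (n - 2 * r) (B_parent n r x) + ball_rank s (n - 2 * r) y + (s - 1)"
      "reach (B_tree n r) (B_parent n r x) k y" by blast
    have "{x, B_parent n r x} \<in> edges (B_tree n r)" using B_edges x that(2) by auto
    then have "reach (B_tree n r) x (Suc k) y"
      by (rule reach_step[OF _ _ k(2)]) (simp add: B_vertices that(2))
    moreover have "Suc k \<le> ball_rank s (n - 2 * r) x + ball_rank s (n - 2 * r) y + (s - 1)"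
      using k(1) B_rank_parent(2)[OF assms(1) x that(1)] by simp
    ultimately show ?thesis by blast
  qed
  consider "s \<le> w" | "s \<le> z" | "w < s" "z < s" by linarith
  then show ?case
  proof cases
    case 1
    then show ?thesis using up less.prems by blast
  next
    case 2
    then obtain k where "k \<le> ball_rank s (n - 2 * r) z + ball_rank s (n - 2 * r) w + (s - 1)" "reach (B_tree n r) z k w"
      using up[of z w] less.prems by (auto simp: add.commute)
    then show ?thesis by (intro exI[of _ k]) (auto intro: reach_sym)
  next
    case 3
    show ?thesis
    proof (cases "w = z")
      case True
      then show ?thesis using reach_refl[of z "B_tree n r"] less.prems by (auto simp: B_vertices)
    next
      case False
      then have s2: "s = 2" "{w, z} = {1, 0}" using 3 assms(1) by auto
      have "B_parent n r 1 = 0" using B_parent_less[of 1] by simp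
      then have "{1, 0} \<in> edges (B_tree n r)"
        unfolding B_edges using nr by (intro image_eqI[of _ _ 1]) auto
      then have "reach (B_tree n r) w 1 z"
        using reach_step[OF _ _ reach_refl[of z "B_tree n r"], of w] s2 less.prems by (simp add: B_vertices)
      then show ?thesis using s2 by (intro exI[of _ 1]) auto
    qed
  qed
qed

text \<open>All ranks are at most \<open>m\<close> because \<open>ball_bound\<close> reaches
  \<open>n\<close> there, so every distance from \<open>w\<close> is at most its rank plus
  \<open>m + s - 1\<close>, and \<open>m + s - 1\<close> is \<open>\<rho>\<close>.\<close>

lemma B_ecc:
  assumes "s \<in> {1, 2}" "n \<le> ball_bound s (n - 2 * r) m" "Suc \<rho> = m + s" "w < n"
  shows "eccentricity (B_tree n r) w \<le> \<rho> + ball_rank s (n - 2 * r) w" and "0 < eccentricity (B_tree n r) w"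
proof -
  have fin: "finite (vertices (B_tree n r))" by (simp add: B_vertices)
  show "eccentricity (B_tree n r) w \<le> \<rho> + ball_rank s (n - 2 * r) w"
  proof (rule ecc_le[OF fin])
    show "vertices (B_tree n r) \<noteq> {}" using assms(4) by (auto simp: B_vertices)
    fix z assume "z \<in> vertices (B_tree n r)"
    then have z: "z < n" by (simp add: B_vertices)
    obtain k where k: "k \<le> ball_rank s (n - 2 * r) w + ball_rank s (n - 2 * r) z + (s - 1)" "reach (B_tree n r) w k z"
      using B_reach[OF assms(1,4) z] by blast
    have "1 \<le> s" using assms(1) by auto
    then have "ball_rank s (n - 2 * r) z \<le> m" using ball_rank_le_iff z assms(2) by simp
    then show "graph_dist (B_tree n r) w z \<le> \<rho> + ball_rank s (n - 2 * r) w"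
      using k(1) graph_dist_le[OF k(2)] assms(1,3) by auto
  qed
  define z where "z = (if w = 0 then 1 else 0 :: nat)"
  have z: "z < n" "w \<noteq> z" using nr by (auto simp: z_def)
  then show "0 < eccentricity (B_tree n r) w"
    using ecc_pos[OF fin _ _ z(2)] B_reach[OF assms(1,4) z(1)] by (auto simp: B_vertices)
qed

text \<open>Upper bounds for the eccentricities of a vertex and its parent are lower bounds for the
  weight of the edge between them.\<close>

lemma B_xi_ge:
  assumes "s \<in> {1, 2}" "n \<le> ball_bound s (n - 2 * r) m" "Suc \<rho> = m + s"
  shows "(\<Sum>w \<in> {1..<n}. edge_weight \<rho> (ball_rank s (n - 2 * r) w)) \<le> xi_ce (B_tree n r)"
proof -
  have V: "{..<n} - {0} = {1..<n}" by auto
  show ?thesis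
    unfolding parent_tree_xi[OF B_parent_tree] B_vertices V
  proof (rule sum_mono)
    fix w assume w: "w \<in> {1..<n}"
    let ?p = "B_parent n r w"
    have p: "?p < n" using B_parent_less[of w] w by simp
    have "eccentricity (B_tree n r) ?p \<le> \<rho> + (ball_rank s (n - 2 * r) w - 1)"
      using B_ecc(1)[OF assms p] B_rank_parent(1)[OF assms(1), of w] w by simp
    then show "edge_weight \<rho> (ball_rank s (n - 2 * r) w)
        \<le> 1 / real (eccentricity (B_tree n r) w) + 1 / real (eccentricity (B_tree n r) ?p)"
      unfolding edge_weight_def
      using B_ecc[OF assms, of w] B_ecc(2)[OF assms p] w
      by (intro add_mono frac_le) auto
  qed
qed

end

section \<open>Comparing \<open>T\<close> with \<open>B(n, r)\<close> vertex by vertex through their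
  ranks\<close>

theorem theorem4p2:
  fixes n r :: nat and T :: "'a ugraph"
  assumes "1 \<le> r" and "real r \<le> real n / 2 - 1"
    and "is_tree T" and "card (vertices T) = n" and "card (branching_vertices T) = r"
  shows "xi_ce T \<le> xi_ce (B_tree n r)"
proof -
  have nr: "2 * r + 2 \<le> n" using assms(2) by linarith
  then have n2: "2 \<le> n" by simp
  obtain c s m \<rho> where c: "c \<in> vertices T" and s: "s \<in> {1, 2}" and rho: "0 < \<rho>" "Suc \<rho> = m + s"
    and m: "n \<le> ball_bound s (n - 2 * r) m"
    and xi: "xi_ce T = (\<Sum>x \<in> vertices T - {c}. edge_weight \<rho> (eccentricity T x - \<rho>))"
    and cnt: "\<And>j. card {x \<in> vertices T - {c}. eccentricity T x - \<rho> \<le> j} < ball_bound s (n - 2 * r) j"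
    by (rule tree_xi_shape[OF assms(3,4) n2 assms(5) nr]) (rule that)
  have fin: "finite (vertices T)" using assms(3) unfolding is_tree_def simple_graph_def by auto
  have cardX: "card (vertices T - {c}) = n - 1" using c fin assms(4) by simp
  have s1: "1 \<le> s" using s by auto
  have "xi_ce T \<le> (\<Sum>w \<in> {1..<n}. edge_weight \<rho> (ball_rank s (n - 2 * r) w))"
    unfolding xi
  proof (rule sum_antimono_le)
    fix j
    \<comment> \<open>Ranks attain the bound for every \<open>j\<close>, up to the cap
      \<open>n\<close>. The omitted vertex 0 matches the omitted \<open>c\<close>, which is why
      \<open>cnt\<close> is strict.\<close>
    have "{w \<in> {1..<n}. ball_rank s (n - 2 * r) w \<le> j} = {1..<min n (ball_bound s (n - 2 * r) j)}"
      using ball_rank_le_iff[OF s1] by auto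
    moreover have "card {x \<in> vertices T - {c}. eccentricity T x - \<rho> \<le> j} \<le> n - 1"
      using card_mono[of "vertices T - {c}"] fin cardX by (metis (no_types, lifting) finite_Diff mem_Collect_eq subsetI)
    ultimately show "card {x \<in> vertices T - {c}. eccentricity T x - \<rho> \<le> j}
        \<le> card {w \<in> {1..<n}. ball_rank s (n - 2 * r) w \<le> j}"
      using cnt[of j] by simp
  qed (use fin cardX edge_weight_antimono[OF rho(1)] in auto)
  also have "\<dots> \<le> xi_ce (B_tree n r)"
    by (rule B_xi_ge[OF assms(1) nr s m rho(2)])
  finally show ?thesis .
qed

end
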